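(* Consider the D2T4 scheme in breathing moments, $m_r(t+\Delta t)=\exp(-\Delta t\,\Lambda_r)\,J_{0r}\,m_r(t)$ (with $\Lambda_r$, $J_{0r}$ as in the context), in the acoustic case: three conserved scalar quantities, $\rho$ and the momentum $J=(j_x,j_y)$, and equilibrium of the last moment $e$ equal to $\alpha\lambda^2\rho$. Assume $s_e\neq0$ and $\alpha+3\ne0$. Then the system of second order equivalent partial differential equations of the scheme is $$\begin{cases}\dfrac{\partial\rho}{\partial t}+{\rm div}\,J={\rm O}(\Delta t^2)\\[2mm]\dfrac{\partial J}{\partial t}+c_0^2\,\nabla\rho-\zeta\,\nabla({\rm div}\,J)={\rm O}(\Delta t^2)\end{cases}$$ with ${\rm div}\,J=\partial_xj_x+\partial_yj_y$ and $$c_0^2=\frac{\lambda^2}{8}(\alpha+3),\qquad\zeta=\frac{\lambda^2}{8}\,\Delta t\,(1-\alpha)\,\sigma_e,\qquad\sigma_e=\frac1{s_e}-\frac12 .$$ That is, in the notation of the context, $(\alpha_1+\Delta t\,\alpha_2)\,(\rho,j_x,j_y)^{\rm t}=\big({\rm div}\,J,\ c_0^2\,\partial_x\rho-\zeta\,\partial_x{\rm div}\,J,\ c_0^2\,\partial_y\rho-\zeta\,\partial_y{\rm div}\,J\big)^{\rm t}$. The viscous term in the momentum equation corresponds to a bulk viscosity; the shear viscosity of this model is zero.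
   Context: Parameters: $\Delta t>0$, $\lambda>0$ fixed, real $\alpha,s_e$. Velocities: $v_1^\ell=(\lambda,0)$, $v_2^\ell=(-\frac12\lambda,\frac{\sqrt3}2\lambda)$, $v_3^\ell=(-\frac12\lambda,-\frac{\sqrt3}2\lambda)$, $v_j^r=-v_j^\ell$; $\xi.\nabla=\xi_x\partial_x+\xi_y\partial_y$. Matrices ($M^{-\ell}=(M^\ell)^{-1}$, $M^{-r}=(M^r)^{-1}$): $$M^\ell=\begin{pmatrix}1&1&1&1\\0&\lambda&-\frac12\lambda&-\frac12\lambda\\0&0&\frac{\sqrt3}{2}\lambda&-\frac{\sqrt3}{2}\lambda\\-3\lambda^2&\lambda^2&\lambda^2&\lambda^2\end{pmatrix},\quad M^r=\begin{pmatrix}1&1&1&1\\0&-\lambda&\frac12\lambda&\frac12\lambda\\0&0&-\frac{\sqrt3}{2}\lambda&\frac{\sqrt3}{2}\lambda\\-3\lambda^2&\lambda^2&\lambda^2&\lambda^2\end{pmatrix},$$ $$w.\nabla=\mathrm{diag}\big(0,0,(v_2^\ell-v_1^\ell).\nabla,(v_3^\ell-v_1^\ell).\nabla,0,0,(v_2^r-v_1^r).\nabla,(v_3^r-v_1^r).\nabla\big),$$ $$N_0=\begin{pmatrix}{\rm I}_4&{\rm I}_4\\-{\rm I}_4&{\rm I}_4\end{pmatrix},\quad N_1=\begin{pmatrix}{\rm I}_4&0\\0&N_1'\end{pmatrix},\quad N_1'=\begin{pmatrix}\frac14&0&0&-\frac1{4\lambda^2}\\0&1&0&0\\0&0&1&0\\\frac34&0&0&\frac1{4\lambda^2}\end{pmatrix},\quad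 R_p=\mathrm{diag}(1,1,1,1,1,-1,-1,-1),$$ $$J_0=\begin{pmatrix}1&0&0&0\\0&1&0&0\\0&0&1&0\\\alpha\lambda^2s_e&0&0&1-s_e\end{pmatrix},\qquad J_{0d}=\begin{pmatrix}J_0&0\\0&J_0\end{pmatrix},$$ $$\Lambda_r=N_1N_0\begin{pmatrix}M^\ell&0\\0&M^r\end{pmatrix}(w.\nabla)\begin{pmatrix}M^{-\ell}&0\\0&M^{-r}\end{pmatrix}N_0^{-1}N_1^{-1},\qquad J_{0r}=N_1N_0J_{0d}N_0^{-1}N_1^{-1}R_p.$$ The vector $m_r$ collects eight moments for a pair $X=(x^\ell,x^r)$ of neighboring triangle centers: $m_r=R_p^{-1}N_1N_0\,m_d$, with $m_d=(m(x^\ell),m(x^r))^{\rm t}$ and $m=(\rho,J_x,J_y,e)^{\rm t}$ the moments in each triangle. Second order equivalent partial differential equations. Split $m_r=(W,Y)$, where $W$ consists of the first three components of $m_r$ (denoted $(\rho,j_x,j_y)$) and $Y$ of the five others. Correspondingly $J_{0r}$ has the form $J_{0r}=\begin{pmatrix}{\rm I}&0\\S\,E&{\rm I}-S\end{pmatrix}$, with $$E=\begin{pmatrix}\lambda^2\alpha&0&0\\0&0&0\\0&0&0\\0&0&0\\0&0&0\end{pmatrix},\qquad S=\begin{pmatrix}s_e&0&0&0&0\\0&\frac14s_e(\alpha+3)&0&0&\frac14s_e(1-\alpha)\\0&0&2&0&0\\0&0&0&2&0\\0&-\frac14s_e(\alpha+3)&0&0&2-\frac14s_e(1-\alpha)\end{pmatrix},$$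 and $\Lambda_r=\begin{pmatrix}A&B\\C&D\end{pmatrix}$ is split into blocks with $A$ of size $3\times3$ and $D$ of size $5\times5$ (entries are constant-coefficient first-order differential operators, which commute). Set $\Sigma=S^{-1}-\frac12{\rm I}_5$. By definition, the system of second order equivalent partial differential equations is $\partial_tW+\alpha_1W+\Delta t\,\alpha_2W={\rm O}(\Delta t^2)$ (formal expansion as $\Delta t\to0$, $\lambda$ fixed), where $$\alpha_1=A+B\,E,\qquad\beta_1=E\,\alpha_1-(C+D\,E),\qquad\alpha_2=B\,\Sigma\,\beta_1 .$$ *)

theory Defs
  imports
    "HOL-Analysis.Derivative"
    "HOL-Library.Landau_Symbols"
    "HOL-Computational_Algebra.Polynomial"
    "Jordan_Normal_Form.Gauss_Jordan_Elimination"
begin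

section \<open>Fields on the plane and constant-coefficient differential operators\<close>

type_synonym field2 = "real \<times> real \<Rightarrow> real"

definition pdx :: "field2 \<Rightarrow> field2" where
  "pdx f = (\<lambda>(x, y). deriv (\<lambda>s. f (s, y)) x)"

definition pdy :: "field2 \<Rightarrow> field2" where
  "pdy f = (\<lambda>(x, y). deriv (\<lambda>s. f (x, s)) y)"

text \<open>
  \<open>C\<^sup>\<infinity>\<close> fields: every iterated partial derivative is (Frechet) differentiable everywhere.
\<close>

coinductive smooth_field :: "field2 \<Rightarrow> bool" where
  "(\<And>p. f differentiable (at p)) \<Longrightarrow> smooth_field (pdx f) \<Longrightarrow> smooth_field (pdy f)
     \<Longrightarrow> smooth_field f"

definition divg :: "field2 \<Rightarrow> field2 \<Rightarrow> field2" where
  "divg jx jy = (\<lambda>p. pdx jx p + pdy jy p)"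

definition laplacian2 :: "field2 \<Rightarrow> field2" where
  "laplacian2 f = (\<lambda>p. pdx (pdx f) p + pdy (pdy f) p)"

text \<open>
  The commutative ring of constant-coefficient differential operators is the polynomial ring in
  \<open>\<partial>\<^sub>x\<close> (the inner indeterminate) and \<open>\<partial>\<^sub>y\<close> (the outer one); products
  are compositions. The function \<open>op_fun\<close> lets an operator act on a field.
\<close>

type_synonym diffop = "real poly poly"

definition const_op :: "real \<Rightarrow> diffop" where
  "const_op c = [:[:c:]:]"

definition op_dx :: diffop where
  "op_dx = [:[:0, 1:]:]"

definition op_dy :: diffop where
  "op_dy = [:0, 1:]"

definition op_fun :: "diffop \<Rightarrow> field2 \<Rightarrow> field2" where
  "op_fun P f = (\<lambda>p. \<Sum>j\<le>degree P. \<Sum>i\<le>degree (coeff P j).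
     coeff (coeff P j) i * (pdx ^^ i) ((pdy ^^ j) f) p)"

definition op_mat_fun :: "diffop mat \<Rightarrow> field2 vec \<Rightarrow> field2 vec" where
  "op_mat_fun P F = vec (dim_row P) (\<lambda>i. \<lambda>p. \<Sum>k<dim_col P. op_fun (P $$ (i, k)) (F $ k) p)"

text \<open>The operator \<open>\<xi>.\<nabla>\<close> for a constant vector \<open>\<xi>\<close>.\<close>

definition dir_op :: "real \<times> real \<Rightarrow> diffop" where
  "dir_op \<xi> = const_op (fst \<xi>) * op_dx + const_op (snd \<xi>) * op_dy"

abbreviation const_mat :: "real mat \<Rightarrow> diffop mat" where
  "const_mat \<equiv> map_mat const_op"

text \<open>Only meaningful for invertible matrices.\<close>

definition minv :: "real mat \<Rightarrow> real mat" where
  "minv A = the (mat_inverse A)"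

definition block_diag2 :: "'a::zero mat \<Rightarrow> 'a mat \<Rightarrow> 'a mat" where
  "block_diag2 A B =
     four_block_mat A (0\<^sub>m (dim_row A) (dim_col B)) (0\<^sub>m (dim_row B) (dim_col A)) B"

section \<open>Second order equivalent equations\<close>

text \<open>
  A linear scheme \<open>m(t + \<Delta>t) = exp(- \<Delta>t \<Lambda>) J m(t)\<close> with three conserved and five
  relaxed moments, where \<open>J\<close> has the blocks \<open>I\<close>, \<open>0\<close>, \<open>S E\<close>, \<open>I - S\<close>, enters its
  second order equivalent equations through \<open>\<Lambda>\<close>, \<open>E\<close> and \<open>S\<close>.
\<close>

definition relaxation_matrix :: "real mat \<Rightarrow> real mat \<Rightarrow> real mat" where
  "relaxation_matrix E S = four_block_mat (1\<^sub>m 3) (0\<^sub>m 3 5) (S * E) (1\<^sub>m 5 - S)"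

definition alpha1_op :: "diffop mat \<Rightarrow> real mat \<Rightarrow> diffop mat" where
  "alpha1_op \<Lambda> E = (case split_block \<Lambda> 3 3 of (A, B, C, D) \<Rightarrow> A + B * const_mat E)"

definition beta1_op :: "diffop mat \<Rightarrow> real mat \<Rightarrow> diffop mat" where
  "beta1_op \<Lambda> E = (case split_block \<Lambda> 3 3 of (A, B, C, D) \<Rightarrow>
     const_mat E * alpha1_op \<Lambda> E - (C + D * const_mat E))"

definition Sigma_mat :: "real mat \<Rightarrow> real mat" where
  "Sigma_mat S = minv S - (1/2) \<cdot>\<^sub>m 1\<^sub>m 5"

definition alpha2_op :: "diffop mat \<Rightarrow> real mat \<Rightarrow> real mat \<Rightarrow> diffop mat" where
  "alpha2_op \<Lambda> E S = (case split_block \<Lambda> 3 3 of (A, B, C, D) \<Rightarrow>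
     B * const_mat (Sigma_mat S) * beta1_op \<Lambda> E)"

definition equivalent_op :: "diffop mat \<Rightarrow> real mat \<Rightarrow> real mat \<Rightarrow> real \<Rightarrow> diffop mat" where
  "equivalent_op \<Lambda> E S dt = alpha1_op \<Lambda> E + const_op dt \<cdot>\<^sub>m alpha2_op \<Lambda> E S"

text \<open>
  The system \<open>\<partial>\<^sub>t W + \<alpha>\<^sub>1 W + \<Delta>t \<alpha>\<^sub>2 W = O(\<Delta>t\<^sup>2)\<close>, for a family
  \<open>W \<Delta>t t\<close> of fields indexed by the time step and by time; the \<open>O\<close> is pointwise in
  \<open>t\<close> and in space, for \<open>\<Delta>t \<rightarrow> 0\<close> from above, all other parameters being fixed.
\<close>

definition second_order_equivalent_system ::
    "diffop mat \<Rightarrow> real mat \<Rightarrow> real mat \<Rightarrow> (real \<Rightarrow> real \<Rightarrow> field2 vec) \<Rightarrow> bool" where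
  "second_order_equivalent_system \<Lambda> E S W \<longleftrightarrow>
     (\<forall>i<3. \<forall>t p. (\<lambda>dt. deriv (\<lambda>\<tau>. (W dt \<tau> $ i) p) t
                        + (op_mat_fun (equivalent_op \<Lambda> E S dt) (W dt t) $ i) p)
                   \<in> O[at_right 0](\<lambda>dt. dt\<^sup>2))"

definition regular_family :: "(real \<Rightarrow> real \<Rightarrow> field2) \<Rightarrow> bool" where
  "regular_family u \<longleftrightarrow>
     (\<forall>dt>0. \<forall>t. smooth_field (u dt t) \<and> (\<forall>p. (\<lambda>\<tau>. u dt \<tau> p) differentiable (at t)))"

section \<open>The D2T4 scheme in breathing moments\<close>

text \<open>The index \<open>j\<close> ranges over \<open>1, 2, 3\<close>.\<close>

definition v_l :: "real \<Rightarrow> nat \<Rightarrow> real \<times> real" where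
  "v_l lam j =
     (if j = 1 then (lam, 0)
      else if j = 2 then (- lam / 2, sqrt 3 / 2 * lam)
      else (- lam / 2, - (sqrt 3 / 2 * lam)))"

definition v_r :: "real \<Rightarrow> nat \<Rightarrow> real \<times> real" where
  "v_r lam j = - v_l lam j"

definition M_l :: "real \<Rightarrow> real mat" where
  "M_l lam = mat_of_rows_list 4
     [[1, 1, 1, 1],
      [0, lam, - lam / 2, - lam / 2],
      [0, 0, sqrt 3 / 2 * lam, - (sqrt 3 / 2 * lam)],
      [- 3 * lam\<^sup>2, lam\<^sup>2, lam\<^sup>2, lam\<^sup>2]]"

definition M_r :: "real \<Rightarrow> real mat" where
  "M_r lam = mat_of_rows_list 4
     [[1, 1, 1, 1],
      [0, - lam, lam / 2, lam / 2],
      [0, 0, - (sqrt 3 / 2 * lam), sqrt 3 / 2 * lam],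
      [- 3 * lam\<^sup>2, lam\<^sup>2, lam\<^sup>2, lam\<^sup>2]]"

definition w_nabla :: "real \<Rightarrow> diffop mat" where
  "w_nabla lam = mat_diag 8 (\<lambda>i.
     [0, 0, dir_op (v_l lam 2 - v_l lam 1), dir_op (v_l lam 3 - v_l lam 1),
      0, 0, dir_op (v_r lam 2 - v_r lam 1), dir_op (v_r lam 3 - v_r lam 1)] ! i)"

definition N0 :: "real mat" where
  "N0 = four_block_mat (1\<^sub>m 4) (1\<^sub>m 4) (- 1\<^sub>m 4) (1\<^sub>m 4)"

definition N1 :: "real \<Rightarrow> real mat" where
  "N1 lam = block_diag2 (1\<^sub>m 4) (mat_of_rows_list 4
     [[1/4, 0, 0, - 1 / (4 * lam\<^sup>2)],
      [0, 1, 0, 0],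
      [0, 0, 1, 0],
      [3/4, 0, 0, 1 / (4 * lam\<^sup>2)]])"

definition R_p :: "real mat" where
  "R_p = mat_diag 8 (\<lambda>i. [1, 1, 1, 1, 1, -1, -1, -1] ! i)"

definition J0 :: "real \<Rightarrow> real \<Rightarrow> real \<Rightarrow> real mat" where
  "J0 lam \<alpha> s\<^sub>e = mat_of_rows_list 4
     [[1, 0, 0, 0],
      [0, 1, 0, 0],
      [0, 0, 1, 0],
      [\<alpha> * lam\<^sup>2 * s\<^sub>e, 0, 0, 1 - s\<^sub>e]]"

definition J0d :: "real \<Rightarrow> real \<Rightarrow> real \<Rightarrow> real mat" where
  "J0d lam \<alpha> s\<^sub>e = block_diag2 (J0 lam \<alpha> s\<^sub>e) (J0 lam \<alpha> s\<^sub>e)"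

definition Lambda_r :: "real \<Rightarrow> diffop mat" where
  "Lambda_r lam =
     const_mat (N1 lam) * const_mat N0 * const_mat (block_diag2 (M_l lam) (M_r lam)) * w_nabla lam
     * const_mat (block_diag2 (minv (M_l lam)) (minv (M_r lam)))
     * const_mat (minv N0) * const_mat (minv (N1 lam))"

definition J0r :: "real \<Rightarrow> real \<Rightarrow> real \<Rightarrow> real mat" where
  "J0r lam \<alpha> s\<^sub>e =
     N1 lam * N0 * J0d lam \<alpha> s\<^sub>e * minv N0 * minv (N1 lam) * R_p"

definition E_eq :: "real \<Rightarrow> real \<Rightarrow> real mat" where
  "E_eq lam \<alpha> = mat_of_rows_list 3
     [[lam\<^sup>2 * \<alpha>, 0, 0],
      [0, 0, 0],
      [0, 0, 0],
      [0, 0, 0],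
      [0, 0, 0]]"

definition S_relax :: "real \<Rightarrow> real \<Rightarrow> real mat" where
  "S_relax \<alpha> s\<^sub>e = mat_of_rows_list 5
     [[s\<^sub>e, 0, 0, 0, 0],
      [0, s\<^sub>e * (\<alpha> + 3) / 4, 0, 0, s\<^sub>e * (1 - \<alpha>) / 4],
      [0, 0, 2, 0, 0],
      [0, 0, 0, 2, 0],
      [0, - (s\<^sub>e * (\<alpha> + 3) / 4), 0, 0, 2 - s\<^sub>e * (1 - \<alpha>) / 4]]"

section \<open>Linear acoustics\<close>

definition sigma_e :: "real \<Rightarrow> real" where
  "sigma_e s\<^sub>e = 1 / s\<^sub>e - 1/2"

text \<open>The square of the sound speed; it need not be positive for the given parameters.\<close>

definition c0_sq :: "real \<Rightarrow> real \<Rightarrow> real" where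
  "c0_sq lam \<alpha> = lam\<^sup>2 / 8 * (\<alpha> + 3)"

definition zeta :: "real \<Rightarrow> real \<Rightarrow> real \<Rightarrow> real \<Rightarrow> real" where
  "zeta lam \<alpha> s\<^sub>e dt = lam\<^sup>2 / 8 * dt * (1 - \<alpha>) * sigma_e s\<^sub>e"

text \<open>
  The spatial part of isotropic linear acoustics with shear viscosity \<open>\<nu>\<close> and bulk viscosity
  \<open>\<mu>\<close>. In two dimensions the divergence of the viscous stress
  \<open>\<nu> (\<nabla>J + (\<nabla>J)\<^sup>t - (div J) I) + \<mu> (div J) I\<close> is
  \<open>\<nu> \<Delta>J + \<mu> \<nabla>(div J)\<close>.
\<close>

definition viscous_acoustics ::
    "real \<Rightarrow> real \<Rightarrow> real \<Rightarrow> field2 \<Rightarrow> field2 \<Rightarrow> field2 \<Rightarrow> field2 vec" where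
  "viscous_acoustics c2 \<nu> \<mu> \<rho> jx jy = vec_of_list
     [divg jx jy,
      \<lambda>p. c2 * pdx \<rho> p - \<nu> * laplacian2 jx p - \<mu> * pdx (divg jx jy) p,
      \<lambda>p. c2 * pdy \<rho> p - \<nu> * laplacian2 jy p - \<mu> * pdy (divg jx jy) p]"

end

theory Submission
  imports Defs "Jordan_Normal_Form.Determinant"
begin

text \<open>
  Every matrix of the scheme is explicit, so \<open>\<Lambda>\<^sub>r\<close> is computed from its factors. In it the row
  of \<open>B\<close> belonging to \<open>\<rho>\<close> only meets the last relaxed moment, where \<open>\<Sigma>\<close> picks up the
  second row of \<open>\<beta>\<^sub>1\<close>, which vanishes: the mass equation gets no second order term. The
  rows of \<open>B \<Sigma>\<close> belonging to the momentum reduce to \<open>\<sigma>\<^sub>e/8 (\<partial>\<^sub>x, \<partial>\<^sub>y)\<close> acting on the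
  first row of \<open>\<beta>\<^sub>1\<close>, which is \<open>(\<alpha> - 1) \<lambda>\<^sup>2 div\<close>; hence the pure gradient of the
  divergence. On fields, regrouping the second derivatives as \<open>\<nabla>(div J)\<close> needs the symmetry of
  mixed partials. The shear field \<open>jx = y\<^sup>2\<close> and the compressive field \<open>jx = x\<^sup>2\<close>
  separate the two viscosities.
\<close>

section \<open>Partial derivatives of smooth fields\<close>

text \<open>\<open>deriv\<close> is total, so \<open>pdx\<close> is meaningful only where the
  derivative exists; composing \<open>f\<close> with the embedding of a horizontal line supplies
  existence.\<close>

lemma pdx_has_derivative:
  assumes "f differentiable (at (x, y))"
  shows "((\<lambda>s. f (s, y)) has_real_derivative pdx f (x, y)) (at x)"
proof -
  have "(\<lambda>s. f (s, y)) differentiable (at x)"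
    using differentiable_chain_at[of "\<lambda>s. (s, y)" x f] assms
    by (simp add: o_def differentiable_Pair)
  then show ?thesis
    by (simp add: pdx_def DERIV_deriv_iff_real_differentiable)
qed

lemma pdy_has_derivative:
  assumes "f differentiable (at (x, y))"
  shows "((\<lambda>s. f (x, s)) has_real_derivative pdy f (x, y)) (at y)"
proof -
  have "(\<lambda>s. f (x, s)) differentiable (at y)"
    using differentiable_chain_at[of "\<lambda>s. (x, s)" y f] assms
    by (simp add: o_def differentiable_Pair)
  then show ?thesis
    by (simp add: pdy_def DERIV_deriv_iff_real_differentiable)
qed

lemma
  assumes "smooth_field f"
  shows smooth_field_differentiable: "f differentiable (at p)"
    and smooth_field_pdx: "smooth_field (pdx f)"
    and smooth_field_pdy: "smooth_field (pdy f)"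
  using assms by (auto elim: smooth_field.cases)

lemma pdx_divg:
  assumes "smooth_field f" "smooth_field g"
  shows "pdx (divg f g) p = pdx (pdx f) p + pdx (pdy g) p"
proof (cases p)
  case (Pair x y)
  have "((\<lambda>s. pdx f (s, y) + pdy g (s, y)) has_real_derivative
      pdx (pdx f) (x, y) + pdx (pdy g) (x, y)) (at x)"
    using assms by (intro DERIV_add pdx_has_derivative smooth_field_differentiable
        smooth_field_pdx smooth_field_pdy)
  then show ?thesis
    unfolding Pair pdx_def[of "divg f g"] by (simp add: divg_def DERIV_imp_deriv)
qed

lemma pdy_divg:
  assumes "smooth_field f" "smooth_field g"
  shows "pdy (divg f g) p = pdy (pdx f) p + pdy (pdy g) p"
proof (cases p)
  case (Pair x y)
  have "((\<lambda>s. pdx f (x, s) + pdy g (x, s)) has_real_derivative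
      pdy (pdx f) (x, y) + pdy (pdy g) (x, y)) (at y)"
    using assms by (intro DERIV_add pdy_has_derivative smooth_field_differentiable
        smooth_field_pdx smooth_field_pdy)
  then show ?thesis
    unfolding Pair pdy_def[of "divg f g"] by (simp add: divg_def DERIV_imp_deriv)
qed

section \<open>Symmetry of mixed partial derivatives\<close>

lemma second_difference_pdy_pdx:
  assumes "smooth_field f" "h > 0"
  shows "\<exists>q\<in>{x<..<x + h} \<times> {y<..<y + h}.
    f (x + h, y + h) - f (x, y + h) - f (x + h, y) + f (x, y) = h\<^sup>2 * pdy (pdx f) q"
proof -
  \<comment> \<open>The second difference is read as the increment in x of
    \<open>f (s, y + h) - f (s, y)\<close>; the mean value theorem in x, then in y, yields the
    point.\<close>
  have "\<exists>s>x. s < x + h \<and> (f (x + h, y + h) - f (x + h, y)) - (f (x, y + h) - f (x, y))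
      = (x + h - x) * (pdx f (s, y + h) - pdx f (s, y))"
    using assms by (intro MVT2[where f = "\<lambda>s. f (s, y + h) - f (s, y)"] DERIV_diff
        pdx_has_derivative smooth_field_differentiable) auto
  then obtain s where s: "x < s" "s < x + h"
    "(f (x + h, y + h) - f (x + h, y)) - (f (x, y + h) - f (x, y))
      = h * (pdx f (s, y + h) - pdx f (s, y))"
    by auto
  have "\<exists>t>y. t < y + h \<and> pdx f (s, y + h) - pdx f (s, y) = (y + h - y) * pdy (pdx f) (s, t)"
    using assms by (intro MVT2[where f = "\<lambda>t. pdx f (s, t)"] pdy_has_derivative
        smooth_field_differentiable smooth_field_pdx) auto
  then obtain t where "y < t" "t < y + h"
    "pdx f (s, y + h) - pdx f (s, y) = h * pdy (pdx f) (s, t)"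
    by auto
  with s show ?thesis
    by (intro bexI[of _ "(s, t)"]) (auto simp: power2_eq_square)
qed

lemma second_difference_pdx_pdy:
  assumes "smooth_field f" "h > 0"
  shows "\<exists>q\<in>{x<..<x + h} \<times> {y<..<y + h}.
    f (x + h, y + h) - f (x, y + h) - f (x + h, y) + f (x, y) = h\<^sup>2 * pdx (pdy f) q"
proof -
  have "\<exists>t>y. t < y + h \<and> (f (x + h, y + h) - f (x, y + h)) - (f (x + h, y) - f (x, y))
      = (y + h - y) * (pdy f (x + h, t) - pdy f (x, t))"
    using assms by (intro MVT2[where f = "\<lambda>t. f (x + h, t) - f (x, t)"] DERIV_diff
        pdy_has_derivative smooth_field_differentiable) auto
  then obtain t where t: "y < t" "t < y + h"
    "(f (x + h, y + h) - f (x, y + h)) - (f (x + h, y) - f (x, y))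
      = h * (pdy f (x + h, t) - pdy f (x, t))"
    by auto
  have "\<exists>s>x. s < x + h \<and> pdy f (x + h, t) - pdy f (x, t) = (x + h - x) * pdx (pdy f) (s, t)"
    using assms by (intro MVT2[where f = "\<lambda>s. pdy f (s, t)"] pdx_has_derivative
        smooth_field_differentiable smooth_field_pdy) auto
  then obtain s where "x < s" "s < x + h"
    "pdy f (x + h, t) - pdy f (x, t) = h * pdx (pdy f) (s, t)"
    by auto
  with t show ?thesis
    by (intro bexI[of _ "(s, t)"]) (auto simp: power2_eq_square)
qed

lemma tendsto_field_shrinking_square:
  fixes g :: field2
  assumes "isCont g (x, y)"
    and "\<And>n. q n \<in> {x<..<x + 1 / real (Suc n)} \<times> {y<..<y + 1 / real (Suc n)}"
  shows "(\<lambda>n. g (q n)) \<longlonglongrightarrow> g (x, y)"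
proof -
  have *: "(\<lambda>n. c + 1 / real (Suc n)) \<longlonglongrightarrow> c" for c :: real
    using LIMSEQ_inverse_real_of_nat_add[of c] by (simp add: inverse_eq_divide)
  have q: "x < fst (q n)" "fst (q n) < x + 1 / real (Suc n)"
    "y < snd (q n)" "snd (q n) < y + 1 / real (Suc n)" for n
    using assms(2)[of n] by (auto simp: mem_Times_iff)
  have "(\<lambda>n. fst (q n)) \<longlonglongrightarrow> x"
    by (rule tendsto_sandwich[OF _ _ tendsto_const *[of x]])
      (use q in \<open>auto intro!: always_eventually less_imp_le\<close>)
  moreover have "(\<lambda>n. snd (q n)) \<longlonglongrightarrow> y"
    by (rule tendsto_sandwich[OF _ _ tendsto_const *[of y]])
      (use q in \<open>auto intro!: always_eventually less_imp_le\<close>)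
  ultimately have "(\<lambda>n. (fst (q n), snd (q n))) \<longlonglongrightarrow> (x, y)"
    by (rule tendsto_Pair)
  then show ?thesis
    using isCont_tendsto_compose[OF assms(1)] by simp
qed

text \<open>Each mixed partial, at a suitable point of a square of side \<open>h\<close>, equals the
  second difference divided by \<open>h\<^sup>2\<close>. As the squares shrink to their corner,
  continuity of both mixed partials identifies the limits.\<close>

lemma pdx_pdy_commute:
  assumes "smooth_field f"
  shows "pdx (pdy f) = pdy (pdx f)"
proof
  fix p :: "real \<times> real"
  obtain x y where p: "p = (x, y)"
    by (cases p)
  have cont: "isCont (pdx (pdy f)) (x, y)" "isCont (pdy (pdx f)) (x, y)"
    using assms by (auto intro!: differentiable_imp_continuous_within smooth_field_differentiable
        smooth_field_pdx smooth_field_pdy)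
  define h where "h n = 1 / real (Suc n)" for n
  have h: "h n > 0" for n
    by (simp add: h_def)
  let ?diff = "\<lambda>n. f (x + h n, y + h n) - f (x, y + h n) - f (x + h n, y) + f (x, y)"
  have "\<forall>n. \<exists>q\<in>{x<..<x + h n} \<times> {y<..<y + h n}. ?diff n = (h n)\<^sup>2 * pdx (pdy f) q"
    using second_difference_pdx_pdy[OF assms h] by blast
  then obtain q where q: "\<And>n. q n \<in> {x<..<x + h n} \<times> {y<..<y + h n}"
    "\<And>n. ?diff n = (h n)\<^sup>2 * pdx (pdy f) (q n)"
    unfolding bchoice_iff Bex_def choice_iff by blast
  have "\<forall>n. \<exists>q\<in>{x<..<x + h n} \<times> {y<..<y + h n}. ?diff n = (h n)\<^sup>2 * pdy (pdx f) q"
    using second_difference_pdy_pdx[OF assms h] by blast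
  then obtain q' where q': "\<And>n. q' n \<in> {x<..<x + h n} \<times> {y<..<y + h n}"
    "\<And>n. ?diff n = (h n)\<^sup>2 * pdy (pdx f) (q' n)"
    unfolding bchoice_iff Bex_def choice_iff by blast
  have "pdx (pdy f) (q n) = pdy (pdx f) (q' n)" for n
    using q(2)[of n] q'(2)[of n] h[of n] by simp
  moreover have "(\<lambda>n. pdx (pdy f) (q n)) \<longlonglongrightarrow> pdx (pdy f) (x, y)"
    using tendsto_field_shrinking_square[OF cont(1)] q(1) by (simp add: h_def)
  moreover have "(\<lambda>n. pdy (pdx f) (q' n)) \<longlonglongrightarrow> pdy (pdx f) (x, y)"
    using tendsto_field_shrinking_square[OF cont(2)] q'(1) by (simp add: h_def)
  ultimately show "pdx (pdy f) p = pdy (pdx f) p"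
    by (simp add: p LIMSEQ_unique)
qed

section \<open>Quadratic test fields\<close>

definition quad_field :: "real \<Rightarrow> real \<Rightarrow> real \<Rightarrow> real \<Rightarrow> real \<Rightarrow> field2" where
  "quad_field a b c d e = (\<lambda>(x, y). a + b * x + c * y + d * x\<^sup>2 + e * y\<^sup>2)"

lemma pdx_quad_field: "pdx (quad_field a b c d e) = quad_field b (2 * d) 0 0 0"
  by (auto simp: pdx_def quad_field_def fun_eq_iff intro!: DERIV_imp_deriv derivative_eq_intros)

lemma pdy_quad_field: "pdy (quad_field a b c d e) = quad_field c 0 (2 * e) 0 0"
  by (auto simp: pdy_def quad_field_def fun_eq_iff intro!: DERIV_imp_deriv derivative_eq_intros)

lemma differentiable_quad_field: "quad_field a b c d e differentiable (at p)"
proof -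
  have "quad_field a b c d e =
      (\<lambda>p. a + b * fst p + c * snd p + d * (fst p)\<^sup>2 + e * (snd p)\<^sup>2)"
    by (auto simp: quad_field_def)
  then show ?thesis
    by (auto simp: differentiable_def intro!: derivative_eq_intros exI)
qed

text \<open>The whole family is closed under \<open>pdx\<close> and \<open>pdy\<close>, which change
  the coefficients; so the coinduction runs over all \<open>quad_field\<close> instances at
  once.\<close>

lemma smooth_quad_field: "smooth_field (quad_field a b c d e)"
proof -
  have "smooth_field f" if "\<exists>a b c d e. f = quad_field a b c d e" for f
    using that
    by (coinduction arbitrary: f)
      (auto simp: pdx_quad_field pdy_quad_field differentiable_quad_field; blast)
  then show ?thesis
    by blast
qed

section \<open>Matrices given by lists of rows\<close>

text \<open>A right inverse of a square matrix over a field is two-sided, so \<open>A\<close> is a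
  unit, \<open>mat_inverse\<close> returns some \<open>C\<close>, and
  \<open>C = C * (A * B) = B\<close>. An explicit candidate for an inverse thus needs one product as
  check.\<close>

lemma minv_eqI:
  assumes A: "A \<in> carrier_mat n n" and B: "B \<in> carrier_mat n n" and AB: "A * B = 1\<^sub>m n"
  shows "minv A = B"
proof -
  have BA: "B * A = 1\<^sub>m n"
    using mat_mult_left_right_inverse[OF A B AB] .
  have "A \<in> Units (ring_mat TYPE(real) n ())"
    using A B AB BA by (auto simp: Units_def ring_mat_def)
  then obtain C where C: "mat_inverse A = Some C"
    using mat_inverse(1)[OF A] by fastforce
  then have CA: "C * A = 1\<^sub>m n" and C_dim: "C \<in> carrier_mat n n"
    using mat_inverse(2)[OF A C] by auto
  have "C = C * (A * B)"
    using AB C_dim by simp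
  also have "\<dots> = B"
    using CA A B C_dim by (simp flip: assoc_mult_mat)
  finally show ?thesis
    by (simp add: minv_def C)
qed

lemma upt_eval:
  "[0..<3] = [0, 1, 2]" "[0..<4] = [0, 1, 2, 3]" "[0..<5] = [0, 1, 2, 3, 4]"
  "[0..<8] = [0, 1, 2, 3, 4, 5, 6, 7]"
  by (simp_all add: upt_rec)

lemma replicate_eval:
  "replicate 3 x = [x, x, x]" "replicate 4 x = [x, x, x, x]" "replicate 5 x = [x, x, x, x, x]"
  "replicate 8 x = [x, x, x, x, x, x, x, x]"
  by (simp_all add: eval_nat_numeral)

text \<open>Applied as a substitution, it turns a matrix given by an index function into an explicit
  row list whose entries can be simplified.\<close>

lemma mat_of_rows_list_entries:
  "A = mat_of_rows_list (dim_col A) (map (\<lambda>i. map (\<lambda>j. A $$ (i, j)) [0..<dim_col A]) [0..<dim_row A])"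
  by (rule eq_matI) (auto simp: mat_of_rows_list_def)

text \<open>A row times a matrix, as a linear combination of the rows: recursion on lists lets
  concrete products be evaluated by simplification. The width \<open>n\<close> is carried along for
  the empty combination.\<close>

fun row_mult :: "nat \<Rightarrow> 'a::semiring_0 list \<Rightarrow> 'a list list \<Rightarrow> 'a list" where
  "row_mult n (c # cs) (r # rs) = map2 (+) (map ((*) c) r) (row_mult n cs rs)"
| "row_mult n _ _ = replicate n 0"

lemma length_row_mult: "\<forall>r\<in>set B. length r = n \<Longrightarrow> length (row_mult n cs B) = n"
  by (induction n cs B rule: row_mult.induct) auto

lemma nth_row_mult:
  "\<lbrakk>\<forall>r\<in>set B. length r = n; length cs = length B; j < n\<rbrakk>
    \<Longrightarrow> row_mult n cs B ! j = (\<Sum>k<length B. cs ! k * B ! k ! j)"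
  by (induction n cs B rule: row_mult.induct)
    (auto simp: length_row_mult sum.lessThan_Suc_shift simp del: sum.lessThan_Suc)

text \<open>The width \<open>m\<close> is a separate variable so that numerals match it; its
  agreement with \<open>length B\<close> becomes a side condition.\<close>

lemma mat_of_rows_list_mult:
  assumes "\<forall>r\<in>set A. length r = length B" "\<forall>r\<in>set B. length r = n" "m = length B"
  shows "mat_of_rows_list m A * mat_of_rows_list n B
    = mat_of_rows_list n (map (\<lambda>r. row_mult n r B) A)"
proof (rule eq_matI)
  fix i j
  assume ij: "i < dim_row (mat_of_rows_list n (map (\<lambda>r. row_mult n r B) A))"
    "j < dim_col (mat_of_rows_list n (map (\<lambda>r. row_mult n r B) A))"
  then have "length (A ! i) = length B"
    using assms(1) by (simp add: mat_of_rows_list_def)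
  then show "(mat_of_rows_list m A * mat_of_rows_list n B) $$ (i, j)
      = mat_of_rows_list n (map (\<lambda>r. row_mult n r B) A) $$ (i, j)"
    using ij assms
    by (simp add: mat_of_rows_list_def nth_row_mult scalar_prod_def lessThan_atLeast0)
qed (simp_all add: mat_of_rows_list_def)

lemma mat_of_rows_list_add:
  assumes "length A = length B" "\<forall>r\<in>set A. length r = n" "\<forall>r\<in>set B. length r = n"
  shows "mat_of_rows_list n A + mat_of_rows_list n B
    = mat_of_rows_list n (map2 (map2 (+)) A B)"
  using assms by (intro eq_matI) (auto simp: mat_of_rows_list_def)

lemma mat_of_rows_list_diff:
  fixes A :: "'a::group_add list list"
  assumes "length A = length B" "\<forall>r\<in>set A. length r = n" "\<forall>r\<in>set B. length r = n"
  shows "mat_of_rows_list n A - mat_of_rows_list n B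
    = mat_of_rows_list n (map2 (map2 (-)) A B)"
  using assms by (intro eq_matI) (auto simp: mat_of_rows_list_def)

lemma mat_of_rows_list_map:
  assumes "\<forall>r\<in>set A. length r = n"
  shows "map_mat f (mat_of_rows_list n A) = mat_of_rows_list n (map (map f) A)"
  using assms by (intro eq_matI) (auto simp: mat_of_rows_list_def)

lemma mat_of_rows_list_smult:
  assumes "\<forall>r\<in>set A. length r = n"
  shows "c \<cdot>\<^sub>m mat_of_rows_list n A = mat_of_rows_list n (map (map ((*) c)) A)"
  using assms by (intro eq_matI) (auto simp: mat_of_rows_list_def)

lemma four_block_mat_of_rows_list:
  assumes "length A = length B" "length C = length D"
    and "\<forall>r\<in>set A. length r = n" "\<forall>r\<in>set B. length r = m"
    and "\<forall>r\<in>set C. length r = n" "\<forall>r\<in>set D. length r = m"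
  shows "four_block_mat (mat_of_rows_list n A) (mat_of_rows_list m B)
      (mat_of_rows_list n C) (mat_of_rows_list m D)
    = mat_of_rows_list (n + m) (map2 (@) A B @ map2 (@) C D)"
  using assms by (intro eq_matI) (auto simp: mat_of_rows_list_def nth_append)

lemma split_block_mat_of_rows_list:
  assumes "\<forall>r\<in>set A. length r = n" "k \<le> length A" "l \<le> n"
  shows "split_block (mat_of_rows_list n A) k l =
    (mat_of_rows_list l (map (take l) (take k A)),
     mat_of_rows_list (n - l) (map (drop l) (take k A)),
     mat_of_rows_list l (map (take l) (drop k A)),
     mat_of_rows_list (n - l) (map (drop l) (drop k A)))"
  using assms
  by (auto simp: split_block_def Let_def mat_of_rows_list_def min_def add.commute intro!: eq_matI)

lemma mat_of_rows_list_carrier: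
  "length A = m \<Longrightarrow> mat_of_rows_list n A \<in> carrier_mat m n"
  by (simp add: mat_of_rows_list_def)

section \<open>First and second order operators\<close>

lemma const_op_simps [simp]:
  "const_op 0 = 0" "const_op 1 = 1"
  by (simp_all add: const_op_def one_pCons)

lemma const_op_mult: "const_op a * const_op b = const_op (a * b)"
  by (simp add: const_op_def)

lemma const_op_add: "const_op a + const_op b = const_op (a + b)"
  by (simp add: const_op_def)

lemma const_op_sum: "const_op (sum f A) = (\<Sum>x\<in>A. const_op (f x))"
  by (induction A rule: infinite_finite_induct) (simp_all flip: const_op_add)

text \<open>Holds because \<open>const_op\<close> is a ring homomorphism. It lets the real factors
  of \<open>Lambda_r\<close> be multiplied before passing to operators.\<close>

lemma const_mat_mult:
  assumes "dim_col A = dim_row B"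
  shows "const_mat (A * B) = const_mat A * const_mat B"
  using assms
  by (intro eq_matI) (simp_all add: scalar_prod_def const_op_sum flip: const_op_mult)

lemma dir_op_poly: "dir_op (a, b) = [:[:0, a:], [:b:]:]"
  by (simp add: dir_op_def const_op_def op_dx_def op_dy_def)

text \<open>First order operators stay encoded by their coefficient pairs, so identities between
  operator matrices reduce to equations between reals.\<close>

lemma dir_op_simps:
  "dir_op (0, 0) = 0"
  "const_op c * dir_op (a, b) = dir_op (c * a, c * b)"
  "dir_op (a, b) * const_op c = dir_op (c * a, c * b)"
  "dir_op (a, b) + dir_op (a', b') = dir_op (a + a', b + b')"
  "dir_op (a, b) - dir_op (a', b') = dir_op (a - a', b - b')"
  "- dir_op (a, b) = dir_op (- a, - b)"
  "dir_op (a, b) = 0 \<longleftrightarrow> a = 0 \<and> b = 0"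
  "0 = dir_op (a, b) \<longleftrightarrow> a = 0 \<and> b = 0"
  "dir_op (a, b) = dir_op (a', b') \<longleftrightarrow> a = a' \<and> b = b'"
  by (auto simp: dir_op_poly const_op_def algebra_simps)

definition quad_op :: "real \<Rightarrow> real \<Rightarrow> real \<Rightarrow> diffop" where
  "quad_op a b c = const_op a * op_dx * op_dx + const_op b * op_dx * op_dy + const_op c * op_dy * op_dy"

lemma quad_op_poly: "quad_op a b c = [:[:0, 0, a:], [:0, b:], [:c:]:]"
  by (simp add: quad_op_def const_op_def op_dx_def op_dy_def)

lemma quad_op_simps:
  "quad_op 0 0 0 = 0"
  "const_op d * quad_op a b c = quad_op (d * a) (d * b) (d * c)"
  "quad_op a b c + quad_op a' b' c' = quad_op (a + a') (b + b') (c + c')"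
  "dir_op (a, b) * dir_op (a', b') = quad_op (a * a') (a * b' + b * a') (b * b')"
  by (auto simp: quad_op_poly dir_op_poly const_op_def algebra_simps)

lemma quad_op_eq_iff:
  "quad_op a b c = 0 \<longleftrightarrow> a = 0 \<and> b = 0 \<and> c = 0"
  "0 = quad_op a b c \<longleftrightarrow> a = 0 \<and> b = 0 \<and> c = 0"
  "quad_op a b c = quad_op a' b' c' \<longleftrightarrow> a = a' \<and> b = b' \<and> c = c'"
  by (auto simp: quad_op_poly)

text \<open>The sums in \<open>op_fun\<close> stop at the actual degrees, which drop when
  coefficients vanish. Padding with zero terms gives bounds that do not depend on the values of the
  coefficients.\<close>

lemma op_fun_bounded:
  assumes "degree P \<le> n" "\<And>j. degree (coeff P j) \<le> m"
  shows "op_fun P f p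
    = (\<Sum>j\<le>n. \<Sum>i\<le>m. coeff (coeff P j) i * (pdx ^^ i) ((pdy ^^ j) f) p)"
proof -
  have "(\<Sum>i\<le>degree (coeff P j). coeff (coeff P j) i * (pdx ^^ i) ((pdy ^^ j) f) p)
      = (\<Sum>i\<le>m. coeff (coeff P j) i * (pdx ^^ i) ((pdy ^^ j) f) p)" for j
    using assms(2) by (intro sum.mono_neutral_left) (auto simp: coeff_eq_0)
  then have "op_fun P f p
      = (\<Sum>j\<le>degree P. \<Sum>i\<le>m. coeff (coeff P j) i * (pdx ^^ i) ((pdy ^^ j) f) p)"
    by (simp add: op_fun_def)
  also have "\<dots> = (\<Sum>j\<le>n. \<Sum>i\<le>m. coeff (coeff P j) i * (pdx ^^ i) ((pdy ^^ j) f) p)"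
    using assms(1) by (intro sum.mono_neutral_left) (auto simp: coeff_eq_0)
  finally show ?thesis .
qed

lemma op_fun_second_order:
  "op_fun (dir_op (a, b) + quad_op c d e) f p
    = a * pdx f p + b * pdy f p
      + c * pdx (pdx f) p + d * pdx (pdy f) p + e * pdy (pdy f) p"
proof -
  have P: "dir_op (a, b) + quad_op c d e = [:[:0, a, c:], [:b, d:], [:e:]:]"
    by (simp add: dir_op_poly quad_op_poly)
  have "degree [:[:0, a, c:], [:b, d:], [:e:]:] \<le> 2"
    by (simp add: degree_pCons_eq_if)
  moreover have "degree (coeff [:[:0, a, c:], [:b, d:], [:e:]:] j) \<le> 2" for j
    by (auto simp: coeff_pCons degree_pCons_eq_if split: nat.split)
  ultimately show ?thesis
    unfolding P by (subst op_fun_bounded[where n = 2 and m = 2])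
      (simp_all add: eval_nat_numeral)
qed

section \<open>The matrices of the D2T4 scheme\<close>

lemma one_mat_4:
  "1\<^sub>m 4 = mat_of_rows_list 4 [[1, 0, 0, 0],
      [0, 1, 0, 0],
      [0, 0, 1, 0],
      [0, 0, 0, 1]]"
  by (subst mat_of_rows_list_entries) (simp add: upt_eval)

lemma zero_mat_4:
  "0\<^sub>m 4 4 = mat_of_rows_list 4 [[0, 0, 0, 0],
      [0, 0, 0, 0],
      [0, 0, 0, 0],
      [0, 0, 0, 0]]"
  by (subst mat_of_rows_list_entries) (simp add: upt_eval)

lemma one_mat_5:
  "1\<^sub>m 5 = mat_of_rows_list 5 [[1, 0, 0, 0, 0],
      [0, 1, 0, 0, 0],
      [0, 0, 1, 0, 0],
      [0, 0, 0, 1, 0],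
      [0, 0, 0, 0, 1]]"
  by (subst mat_of_rows_list_entries) (simp add: upt_eval)

lemma one_mat_8:
  "1\<^sub>m 8 = mat_of_rows_list 8 [[1, 0, 0, 0, 0, 0, 0, 0],
      [0, 1, 0, 0, 0, 0, 0, 0],
      [0, 0, 1, 0, 0, 0, 0, 0],
      [0, 0, 0, 1, 0, 0, 0, 0],
      [0, 0, 0, 0, 1, 0, 0, 0],
      [0, 0, 0, 0, 0, 1, 0, 0],
      [0, 0, 0, 0, 0, 0, 1, 0],
      [0, 0, 0, 0, 0, 0, 0, 1]]"
  by (subst mat_of_rows_list_entries) (simp add: upt_eval)

lemma block_diag2_4:
  assumes "length A = 4" "length B = 4" "\<forall>r\<in>set A. length r = 4" "\<forall>r\<in>set B. length r = 4"
  shows "block_diag2 (mat_of_rows_list 4 A) (mat_of_rows_list 4 B)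
    = mat_of_rows_list 8 (map (\<lambda>r. r @ [0, 0, 0, 0]) A @ map (\<lambda>r. [0, 0, 0, 0] @ r) B)"
proof -
  have dims: "dim_row (mat_of_rows_list 4 A) = 4" "dim_col (mat_of_rows_list 4 A) = 4"
    "dim_row (mat_of_rows_list 4 B) = 4" "dim_col (mat_of_rows_list 4 B) = 4"
    using assms by (simp_all add: mat_of_rows_list_def)
  show ?thesis
    unfolding block_diag2_def dims zero_mat_4
    using assms by (auto simp: four_block_mat_of_rows_list numeral_eq_Suc length_Suc_conv)
qed

lemma N0_list:
  "N0 = mat_of_rows_list 8
    [[1, 0, 0, 0, 1, 0, 0, 0],
      [0, 1, 0, 0, 0, 1, 0, 0],
      [0, 0, 1, 0, 0, 0, 1, 0],
      [0, 0, 0, 1, 0, 0, 0, 1],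
      [- 1, 0, 0, 0, 1, 0, 0, 0],
      [0, - 1, 0, 0, 0, 1, 0, 0],
      [0, 0, - 1, 0, 0, 0, 1, 0],
      [0, 0, 0, - 1, 0, 0, 0, 1]]"
proof -
  have minus: "- 1\<^sub>m 4 = mat_of_rows_list 4
    [[- 1 :: real, 0, 0, 0], [0, - 1, 0, 0], [0, 0, - 1, 0], [0, 0, 0, - 1]]"
    by (subst mat_of_rows_list_entries) (simp add: upt_eval)
  show ?thesis
    \<comment> \<open>The negated block is replaced first, before \<open>one_mat_4\<close> can
      rewrite the identity inside it.\<close>
    unfolding N0_def minus unfolding one_mat_4 by (simp add: four_block_mat_of_rows_list)
qed

text \<open>The rows of \<open>N0\<close> are orthogonal with squared length 2, so the inverse is
  half the transpose.\<close>

lemma minv_N0: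
  "minv N0 = mat_of_rows_list 8
    [[1 / 2, 0, 0, 0, - (1 / 2), 0, 0, 0],
      [0, 1 / 2, 0, 0, 0, - (1 / 2), 0, 0],
      [0, 0, 1 / 2, 0, 0, 0, - (1 / 2), 0],
      [0, 0, 0, 1 / 2, 0, 0, 0, - (1 / 2)],
      [1 / 2, 0, 0, 0, 1 / 2, 0, 0, 0],
      [0, 1 / 2, 0, 0, 0, 1 / 2, 0, 0],
      [0, 0, 1 / 2, 0, 0, 0, 1 / 2, 0],
      [0, 0, 0, 1 / 2, 0, 0, 0, 1 / 2]]"
  by (rule minv_eqI[where n = 8])
    (simp_all add: N0_list one_mat_8 mat_of_rows_list_mult replicate_eval mat_of_rows_list_carrier)

lemma N1_list:
  "N1 lam = mat_of_rows_list 8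
    [[1, 0, 0, 0, 0, 0, 0, 0],
      [0, 1, 0, 0, 0, 0, 0, 0],
      [0, 0, 1, 0, 0, 0, 0, 0],
      [0, 0, 0, 1, 0, 0, 0, 0],
      [0, 0, 0, 0, 1 / 4, 0, 0, - (1 / (4 * lam\<^sup>2))],
      [0, 0, 0, 0, 0, 1, 0, 0],
      [0, 0, 0, 0, 0, 0, 1, 0],
      [0, 0, 0, 0, 3 / 4, 0, 0, 1 / (4 * lam\<^sup>2)]]"
  unfolding N1_def one_mat_4 by (simp add: block_diag2_4)

text \<open>Only components 5 and 8 mix, through a 2 by 2 block of determinant
  \<open>1 / (4 * lam\<^sup>2)\<close>.\<close>

lemma minv_N1:
  assumes "lam \<noteq> 0"
  shows "minv (N1 lam) = mat_of_rows_list 8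
    [[1, 0, 0, 0, 0, 0, 0, 0],
      [0, 1, 0, 0, 0, 0, 0, 0],
      [0, 0, 1, 0, 0, 0, 0, 0],
      [0, 0, 0, 1, 0, 0, 0, 0],
      [0, 0, 0, 0, 1, 0, 0, 1],
      [0, 0, 0, 0, 0, 1, 0, 0],
      [0, 0, 0, 0, 0, 0, 1, 0],
      [0, 0, 0, 0, - (3 * lam\<^sup>2), 0, 0, lam\<^sup>2]]"
  using assms by (intro minv_eqI[where n = 8])
    (simp_all add: N1_list one_mat_8 mat_of_rows_list_mult replicate_eval mat_of_rows_list_carrier)

text \<open>The rows of \<open>M_l lam\<close> are pairwise orthogonal, with squared lengths 4,
  \<open>3/2 * lam\<^sup>2\<close> (twice) and \<open>12 * lam ^ 4\<close>; divided by these they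
  are the columns of the inverse.\<close>

lemma minv_M_l:
  assumes "lam \<noteq> 0"
  shows "minv (M_l lam) = mat_of_rows_list 4
    [[1 / 4, 0, 0, - (1 / (4 * lam\<^sup>2))],
      [1 / 4, 2 / (3 * lam), 0, 1 / (12 * lam\<^sup>2)],
      [1 / 4, - (1 / (3 * lam)), sqrt 3 / (3 * lam), 1 / (12 * lam\<^sup>2)],
      [1 / 4, - (1 / (3 * lam)), - (sqrt 3 / (3 * lam)), 1 / (12 * lam\<^sup>2)]]"
  using assms by (intro minv_eqI[where n = 4])
    (simp_all add: M_l_def one_mat_4 mat_of_rows_list_mult replicate_eval mat_of_rows_list_carrier
      field_simps power2_eq_square)

lemma minv_M_r:
  assumes "lam \<noteq> 0"
  shows "minv (M_r lam) = mat_of_rows_list 4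
    [[1 / 4, 0, 0, - (1 / (4 * lam\<^sup>2))],
      [1 / 4, - (2 / (3 * lam)), 0, 1 / (12 * lam\<^sup>2)],
      [1 / 4, 1 / (3 * lam), - (sqrt 3 / (3 * lam)), 1 / (12 * lam\<^sup>2)],
      [1 / 4, 1 / (3 * lam), sqrt 3 / (3 * lam), 1 / (12 * lam\<^sup>2)]]"
  using assms by (intro minv_eqI[where n = 4])
    (simp_all add: M_r_def one_mat_4 mat_of_rows_list_mult replicate_eval mat_of_rows_list_carrier
      field_simps power2_eq_square)

section \<open>The streaming operator in breathing moments\<close>

text \<open>The first four rows add the moments of the two triangles. In rows 5 and 8,
  \<open>N1\<close> isolates the differences between the triangles of the rest density and of the
  total moving density.\<close>

lemma moments_from_densities:
  assumes "lam \<noteq> 0"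
  shows "N1 lam * N0 * block_diag2 (M_l lam) (M_r lam) = mat_of_rows_list 8
    [[1, 1, 1, 1, 1, 1, 1, 1],
      [0, lam, - (lam / 2), - (lam / 2), 0, - lam, lam / 2, lam / 2],
      [0, 0, sqrt 3 * lam / 2, - (sqrt 3 * lam / 2), 0, 0, - (sqrt 3 * lam / 2), sqrt 3 * lam / 2],
      [- (3 * lam\<^sup>2), lam\<^sup>2, lam\<^sup>2, lam\<^sup>2, - (3 * lam\<^sup>2), lam\<^sup>2, lam\<^sup>2, lam\<^sup>2],
      [- 1, 0, 0, 0, 1, 0, 0, 0],
      [0, - lam, lam / 2, lam / 2, 0, - lam, lam / 2, lam / 2],
      [0, 0, - (sqrt 3 * lam / 2), sqrt 3 * lam / 2, 0, 0, - (sqrt 3 * lam / 2), sqrt 3 * lam / 2],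
      [0, - 1, - 1, - 1, 0, 1, 1, 1]]"
  using assms by (simp add: N1_list N0_list M_l_def M_r_def block_diag2_4 mat_of_rows_list_mult replicate_eval
      field_simps power2_eq_square)

lemma densities_from_moments:
  assumes "lam \<noteq> 0"
  shows "block_diag2 (minv (M_l lam)) (minv (M_r lam)) * minv N0 * minv (N1 lam) = mat_of_rows_list 8
    [[1 / 8, 0, 0, - (1 / (8 * lam\<^sup>2)), - (1 / 2), 0, 0, 0],
      [1 / 8, 1 / (3 * lam), 0, 1 / (24 * lam\<^sup>2), 0, - (1 / (3 * lam)), 0, - (1 / 6)],
      [1 / 8, - (1 / (6 * lam)), sqrt 3 / (6 * lam), 1 / (24 * lam\<^sup>2), 0, 1 / (6 * lam), - (sqrt 3 / (6 * lam)), - (1 / 6)],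
      [1 / 8, - (1 / (6 * lam)), - (sqrt 3 / (6 * lam)), 1 / (24 * lam\<^sup>2), 0, 1 / (6 * lam), sqrt 3 / (6 * lam), - (1 / 6)],
      [1 / 8, 0, 0, - (1 / (8 * lam\<^sup>2)), 1 / 2, 0, 0, 0],
      [1 / 8, - (1 / (3 * lam)), 0, 1 / (24 * lam\<^sup>2), 0, - (1 / (3 * lam)), 0, 1 / 6],
      [1 / 8, 1 / (6 * lam), - (sqrt 3 / (6 * lam)), 1 / (24 * lam\<^sup>2), 0, 1 / (6 * lam), - (sqrt 3 / (6 * lam)), 1 / 6],
      [1 / 8, 1 / (6 * lam), sqrt 3 / (6 * lam), 1 / (24 * lam\<^sup>2), 0, 1 / (6 * lam), sqrt 3 / (6 * lam), 1 / 6]]"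
  using assms by (simp add: minv_N1 minv_N0 minv_M_l minv_M_r block_diag2_4 mat_of_rows_list_mult replicate_eval)

lemma w_nabla_list:
  "w_nabla lam = mat_of_rows_list 8
    [[0, 0, 0, 0, 0, 0, 0, 0],
     [0, 0, 0, 0, 0, 0, 0, 0],
     [0, 0, dir_op (- 3 / 2 * lam, sqrt 3 / 2 * lam), 0, 0, 0, 0, 0],
     [0, 0, 0, dir_op (- 3 / 2 * lam, - (sqrt 3 / 2 * lam)), 0, 0, 0, 0],
     [0, 0, 0, 0, 0, 0, 0, 0],
     [0, 0, 0, 0, 0, 0, 0, 0],
     [0, 0, 0, 0, 0, 0, dir_op (3 / 2 * lam, - (sqrt 3 / 2 * lam)), 0],
     [0, 0, 0, 0, 0, 0, 0, dir_op (3 / 2 * lam, sqrt 3 / 2 * lam)]]"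
  by (subst mat_of_rows_list_entries)
    (simp add: upt_eval w_nabla_def mat_diag_def v_l_def v_r_def)

text \<open>Rest densities are not transported, so row 5 and column 5 vanish. The other moments
  split into 1, 4, 6, 7 and 2, 3, 8; each group is coupled only to the other.\<close>

lemma Lambda_r_list:
  assumes "lam \<noteq> 0"
  shows "Lambda_r lam = mat_of_rows_list 8
    [[0, dir_op (1, 0), dir_op (0, 1), 0, 0, 0, 0, dir_op (lam, 0)],
      [dir_op (3 * lam\<^sup>2 / 8, 0), 0, 0, dir_op (1 / 8, 0), 0, dir_op (lam / 2, 0), dir_op (0, lam / 2), 0],
      [dir_op (0, 3 * lam\<^sup>2 / 8), 0, 0, dir_op (0, 1 / 8), 0, dir_op (0, lam / 2), dir_op (3 * lam / 2, 0), 0],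
      [0, dir_op (lam\<^sup>2, 0), dir_op (0, lam\<^sup>2), 0, 0, 0, 0, dir_op (lam ^ 3, 0)],
      [0, 0, 0, 0, 0, 0, 0, 0],
      [0, dir_op (lam / 2, 0), dir_op (0, lam / 2), 0, 0, 0, 0, dir_op (lam\<^sup>2 / 2, 0)],
      [0, dir_op (0, lam / 2), dir_op (3 * lam / 2, 0), 0, 0, 0, 0, dir_op (0, lam\<^sup>2 / 2)],
      [dir_op (3 * lam / 4, 0), 0, 0, dir_op (1 / (4 * lam), 0), 0, dir_op (1, 0), dir_op (0, 1), 0]]"
proof -
  have carrier: "N1 lam \<in> carrier_mat 8 8" "N0 \<in> carrier_mat 8 8"
    "block_diag2 (M_l lam) (M_r lam) \<in> carrier_mat 8 8" "w_nabla lam \<in> carrier_mat 8 8"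
    by (simp_all add: N1_list N0_list w_nabla_list M_l_def M_r_def block_diag2_4
        mat_of_rows_list_carrier)
  have carrier_inv: "minv N0 \<in> carrier_mat 8 8" "minv (N1 lam) \<in> carrier_mat 8 8"
    "block_diag2 (minv (M_l lam)) (minv (M_r lam)) \<in> carrier_mat 8 8"
    using assms by (simp_all add: minv_N1 minv_N0 minv_M_l minv_M_r block_diag2_4
        mat_of_rows_list_carrier)
  \<comment> \<open>Grouping the constant factors on either side leaves just two products that
    involve operators.\<close>
  have "Lambda_r lam = const_mat (N1 lam * N0 * block_diag2 (M_l lam) (M_r lam)) * w_nabla lam
      * const_mat (block_diag2 (minv (M_l lam)) (minv (M_r lam)) * minv N0 * minv (N1 lam))"
    using carrier carrier_inv by (simp add: Lambda_r_def const_mat_mult assoc_mult_mat[of _ 8 8 _ 8 _ 8])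
  then show ?thesis
    unfolding moments_from_densities[OF assms] densities_from_moments[OF assms] w_nabla_list
    using assms
    by (simp add: mat_of_rows_list_map mat_of_rows_list_mult replicate_eval dir_op_simps)
      (simp add: field_simps power2_eq_square power3_eq_cube)
qed

text \<open>\<open>J0d\<close> has two equal blocks and so commutes with \<open>N0\<close>: sums of
  moments relax by \<open>J0\<close>, differences by \<open>J0\<close> conjugated with the lower
  block of \<open>N1\<close>. \<open>R_p\<close> then negates the last three columns, which produces
  the entries 2 of \<open>S_relax\<close>.\<close>

lemma J0r_eq_relaxation_matrix:
  assumes "lam \<noteq> 0"
  shows "J0r lam \<alpha> s\<^sub>e = relaxation_matrix (E_eq lam \<alpha>) (S_relax \<alpha> s\<^sub>e)"
proof -
  have R: "R_p = mat_of_rows_list 8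
    [[1, 0, 0, 0, 0, 0, 0, 0],
     [0, 1, 0, 0, 0, 0, 0, 0],
     [0, 0, 1, 0, 0, 0, 0, 0],
     [0, 0, 0, 1, 0, 0, 0, 0],
     [0, 0, 0, 0, 1, 0, 0, 0],
     [0, 0, 0, 0, 0, - 1, 0, 0],
     [0, 0, 0, 0, 0, 0, - 1, 0],
     [0, 0, 0, 0, 0, 0, 0, - 1]]"
    by (subst mat_of_rows_list_entries) (simp add: upt_eval R_p_def mat_diag_def)
  have one3: "1\<^sub>m 3 = mat_of_rows_list 3 [[1 :: real, 0, 0], [0, 1, 0], [0, 0, 1]]"
    by (subst mat_of_rows_list_entries) (simp add: upt_eval)
  have zero: "0\<^sub>m 3 5 = mat_of_rows_list 5
    [[0 :: real, 0, 0, 0, 0], [0, 0, 0, 0, 0], [0, 0, 0, 0, 0]]"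
    by (subst mat_of_rows_list_entries) (simp add: upt_eval)
  have "J0r lam \<alpha> s\<^sub>e = mat_of_rows_list 8
    [[1, 0, 0, 0, 0, 0, 0, 0],
     [0, 1, 0, 0, 0, 0, 0, 0],
     [0, 0, 1, 0, 0, 0, 0, 0],
     [\<alpha> * lam\<^sup>2 * s\<^sub>e, 0, 0, 1 - s\<^sub>e, 0, 0, 0, 0],
     [0, 0, 0, 0, 1 - s\<^sub>e * (\<alpha> + 3) / 4, 0, 0, - (s\<^sub>e * (1 - \<alpha>) / 4)],
     [0, 0, 0, 0, 0, - 1, 0, 0],
     [0, 0, 0, 0, 0, 0, - 1, 0],
     [0, 0, 0, 0, s\<^sub>e * (\<alpha> + 3) / 4, 0, 0, s\<^sub>e * (1 - \<alpha>) / 4 - 1]]"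
    unfolding J0r_def minv_N0 minv_N1[OF assms]
    using assms
    by (simp add: J0d_def J0_def N1_list N0_list R block_diag2_4
        mat_of_rows_list_mult replicate_eval)
      (rule arg_cong[where f = "mat_of_rows_list 8"], simp add: field_simps power2_eq_square)
  moreover have "relaxation_matrix (E_eq lam \<alpha>) (S_relax \<alpha> s\<^sub>e) = \<dots>"
    unfolding relaxation_matrix_def one3 one_mat_5 zero
    by (simp add: E_eq_def S_relax_def mat_of_rows_list_mult replicate_eval
        mat_of_rows_list_diff four_block_mat_of_rows_list algebra_simps)
  ultimately show ?thesis
    by simp
qed

text \<open>The block of rows and columns 2 and 5 of \<open>S_relax\<close> has determinant
  \<open>s\<^sub>e * (\<alpha> + 3) / 2\<close>, nonzero by the hypotheses. The relaxation rates 2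
  give zero rows in \<open>Sigma_mat\<close>.\<close>

lemma Sigma_S_relax:
  assumes "s\<^sub>e \<noteq> 0" "\<alpha> + 3 \<noteq> 0"
  shows "Sigma_mat (S_relax \<alpha> s\<^sub>e) = mat_of_rows_list 5
    [[sigma_e s\<^sub>e, 0, 0, 0, 0],
     [0, (4 / s\<^sub>e - 2) / (\<alpha> + 3), 0, 0, - ((1 - \<alpha>) / (2 * (\<alpha> + 3)))],
     [0, 0, 0, 0, 0],
     [0, 0, 0, 0, 0],
     [0, 1 / 2, 0, 0, 0]]"
proof -
  \<comment> \<open>The second diagonal entry is written with a summand 1/2 so that it cancels in
    \<open>Sigma_mat\<close>.\<close>
  have inv: "minv (S_relax \<alpha> s\<^sub>e) = mat_of_rows_list 5
    [[1 / s\<^sub>e, 0, 0, 0, 0],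
     [0, (4 / s\<^sub>e - 2) / (\<alpha> + 3) + 1 / 2, 0, 0, - ((1 - \<alpha>) / (2 * (\<alpha> + 3)))],
     [0, 0, 1 / 2, 0, 0],
     [0, 0, 0, 1 / 2, 0],
     [0, 1 / 2, 0, 0, 1 / 2]]"
    using assms
    by (intro minv_eqI[where n = 5])
      (simp_all add: S_relax_def one_mat_5 mat_of_rows_list_mult replicate_eval
        mat_of_rows_list_carrier, simp add: divide_simps, simp add: algebra_simps)
  show ?thesis
    unfolding Sigma_mat_def inv one_mat_5
    by (simp add: mat_of_rows_list_smult mat_of_rows_list_diff sigma_e_def)
qed

section \<open>First and second order operators of the scheme\<close>

text \<open>The squared sound speed adds \<open>3 * lam\<^sup>2 / 8\<close> from the density column
  to \<open>\<alpha> * lam\<^sup>2 / 8\<close>, contributed by the equilibrium of the energy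
  moment.\<close>

lemma alpha1_Lambda_r:
  assumes "lam \<noteq> 0"
  shows "alpha1_op (Lambda_r lam) (E_eq lam \<alpha>) = mat_of_rows_list 3
    [[0, dir_op (1, 0), dir_op (0, 1)],
     [dir_op (c0_sq lam \<alpha>, 0), 0, 0],
     [dir_op (0, c0_sq lam \<alpha>), 0, 0]]"
  unfolding alpha1_op_def Lambda_r_list[OF assms] E_eq_def
  by (simp add: split_block_mat_of_rows_list mat_of_rows_list_map mat_of_rows_list_mult
      replicate_eval mat_of_rows_list_add dir_op_simps c0_sq_def field_simps)

text \<open>\<open>zeta\<close> is linear in its last argument, so it is taken at time step 1 here;
  \<open>equivalent_op\<close> supplies the factor \<open>dt\<close>.\<close>

lemma alpha2_Lambda_r:
  assumes "lam \<noteq> 0" "s\<^sub>e \<noteq> 0" "\<alpha> + 3 \<noteq> 0"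
  defines "z \<equiv> zeta lam \<alpha> s\<^sub>e 1"
  shows "alpha2_op (Lambda_r lam) (E_eq lam \<alpha>) (S_relax \<alpha> s\<^sub>e) = mat_of_rows_list 3
    [[0, 0, 0],
     [0, quad_op (- z) 0 0, quad_op 0 (- z) 0],
     [0, quad_op 0 (- z) 0, quad_op 0 0 (- z)]]"
  unfolding alpha2_op_def beta1_op_def alpha1_Lambda_r[OF assms(1)]
  \<comment> \<open>\<open>Lambda_r\<close> is expanded only now, because
    \<open>alpha1_Lambda_r\<close> matches its folded form.\<close>
  unfolding Lambda_r_list[OF assms(1)] Sigma_S_relax[OF assms(2,3)]
  using assms(1)
  by (simp add: E_eq_def split_block_mat_of_rows_list mat_of_rows_list_map mat_of_rows_list_mult
      replicate_eval mat_of_rows_list_add mat_of_rows_list_diff dir_op_simps quad_op_simps)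
    (rule arg_cong[where f = "mat_of_rows_list 3"],
      simp add: quad_op_eq_iff z_def zeta_def field_simps)

lemma equivalent_op_Lambda_r:
  fixes dt :: real
  assumes "lam \<noteq> 0" "s\<^sub>e \<noteq> 0" "\<alpha> + 3 \<noteq> 0"
  defines "c \<equiv> c0_sq lam \<alpha>" and "z \<equiv> zeta lam \<alpha> s\<^sub>e dt"
  shows "equivalent_op (Lambda_r lam) (E_eq lam \<alpha>) (S_relax \<alpha> s\<^sub>e) dt = mat_of_rows_list 3
    [[0, dir_op (1, 0), dir_op (0, 1)],
     [dir_op (c, 0), quad_op (- z) 0 0, quad_op 0 (- z) 0],
     [dir_op (0, c), quad_op 0 (- z) 0, quad_op 0 0 (- z)]]"
  unfolding equivalent_op_def alpha1_Lambda_r[OF assms(1)] alpha2_Lambda_r[OF assms(1-3)]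
  by (simp add: mat_of_rows_list_smult mat_of_rows_list_add quad_op_simps)
    (rule arg_cong[where f = "mat_of_rows_list 3"],
      simp add: quad_op_eq_iff c_def z_def zeta_def)

section \<open>The equivalent equations\<close>

lemma op_fun_simps:
  "op_fun 0 f p = 0"
  "op_fun (dir_op (a, b)) f p = a * pdx f p + b * pdy f p"
  "op_fun (quad_op a b c) f p = a * pdx (pdx f) p + b * pdx (pdy f) p + c * pdy (pdy f) p"
  using op_fun_second_order[of 0 0 0 0 0 f p] op_fun_second_order[of a b 0 0 0 f p]
    op_fun_second_order[of 0 0 a b c f p]
  by (simp_all add: dir_op_simps(1) quad_op_simps(1))

lemma op_mat_fun_3:
  "op_mat_fun (mat_of_rows_list 3 [[a, b, c], [a', b', c'], [a'', b'', c'']]) (vec_of_list [f, g, h])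
    = vec_of_list
        [\<lambda>p. op_fun a f p + op_fun b g p + op_fun c h p,
         \<lambda>p. op_fun a' f p + op_fun b' g p + op_fun c' h p,
         \<lambda>p. op_fun a'' f p + op_fun b'' g p + op_fun c'' h p]"
  by (intro eq_vecI) (auto simp: op_mat_fun_def mat_of_rows_list_def less_Suc_eq eval_nat_numeral)

text \<open>Operators act with \<open>pdy\<close> before \<open>pdx\<close>, while the y-derivative
  of the divergence contains \<open>pdy (pdx jx)\<close>; symmetry of mixed partials reconciles the
  two.\<close>

lemma op_mat_fun_equivalent_op:
  assumes "lam \<noteq> 0" "s\<^sub>e \<noteq> 0" "\<alpha> + 3 \<noteq> 0"
    and "smooth_field \<rho>" "smooth_field jx" "smooth_field jy"
  shows "op_mat_fun (equivalent_op (Lambda_r lam) (E_eq lam \<alpha>) (S_relax \<alpha> s\<^sub>e) dt)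
      (vec_of_list [\<rho>, jx, jy])
    = vec_of_list
        [divg jx jy,
         \<lambda>p. c0_sq lam \<alpha> * pdx \<rho> p - zeta lam \<alpha> s\<^sub>e dt * pdx (divg jx jy) p,
         \<lambda>p. c0_sq lam \<alpha> * pdy \<rho> p - zeta lam \<alpha> s\<^sub>e dt * pdy (divg jx jy) p]"
  unfolding equivalent_op_Lambda_r[OF assms(1-3)] op_mat_fun_3
  using assms(4-6)
  by (simp add: op_fun_simps pdx_divg pdy_divg pdx_pdy_commute algebra_simps flip: divg_def)

lemma second_order_equivalent_system_Lambda_r:
  assumes "lam \<noteq> 0" "s\<^sub>e \<noteq> 0" "\<alpha> + 3 \<noteq> 0"
    and regular: "regular_family \<rho>" "regular_family jx" "regular_family jy"
  shows "second_order_equivalent_system (Lambda_r lam) (E_eq lam \<alpha>) (S_relax \<alpha> s\<^sub>e)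
      (\<lambda>dt t. vec_of_list [\<rho> dt t, jx dt t, jy dt t])
    \<longleftrightarrow>
    (\<forall>t p.
      (\<lambda>dt. deriv (\<lambda>\<tau>. \<rho> dt \<tau> p) t + divg (jx dt t) (jy dt t) p)
        \<in> O[at_right 0](\<lambda>dt. dt\<^sup>2) \<and>
      (\<lambda>dt. deriv (\<lambda>\<tau>. jx dt \<tau> p) t + c0_sq lam \<alpha> * pdx (\<rho> dt t) p
           - zeta lam \<alpha> s\<^sub>e dt * pdx (divg (jx dt t) (jy dt t)) p)
        \<in> O[at_right 0](\<lambda>dt. dt\<^sup>2) \<and>
      (\<lambda>dt. deriv (\<lambda>\<tau>. jy dt \<tau> p) t + c0_sq lam \<alpha> * pdy (\<rho> dt t) p
           - zeta lam \<alpha> s\<^sub>e dt * pdy (divg (jx dt t) (jy dt t)) p)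
        \<in> O[at_right 0](\<lambda>dt. dt\<^sup>2))"
proof -
  let ?F = "\<lambda>dt t. op_mat_fun (equivalent_op (Lambda_r lam) (E_eq lam \<alpha>) (S_relax \<alpha> s\<^sub>e) dt)
    (vec_of_list [\<rho> dt t, jx dt t, jy dt t])"
  have F: "?F dt t = vec_of_list
      [divg (jx dt t) (jy dt t),
       \<lambda>p. c0_sq lam \<alpha> * pdx (\<rho> dt t) p - zeta lam \<alpha> s\<^sub>e dt * pdx (divg (jx dt t) (jy dt t)) p,
       \<lambda>p. c0_sq lam \<alpha> * pdy (\<rho> dt t) p - zeta lam \<alpha> s\<^sub>e dt * pdy (divg (jx dt t) (jy dt t)) p]"
    if "dt > 0" for dt t
    using that regular
    by (intro op_mat_fun_equivalent_op[OF assms(1-3)]) (auto simp: regular_family_def)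
  \<comment> \<open>The fields are known to be regular only for positive \<open>dt\<close>, which is
    all that the filter \<open>at_right 0\<close> sees.\<close>
  have O_cong: "g \<in> O[at_right 0](\<lambda>dt. dt\<^sup>2) \<longleftrightarrow> h \<in> O[at_right 0](\<lambda>dt. dt\<^sup>2)"
    if "\<And>dt. dt > 0 \<Longrightarrow> g dt = h dt" for g h :: "real \<Rightarrow> real"
    using that by (intro landau_o.big.in_cong) (auto simp: eventually_at_right_less eventually_at_filter)
  have component: "vec_of_list [u, v, w] $ 0 = u" "vec_of_list [u, v, w] $ 1 = v"
    "vec_of_list [u, v, w] $ 2 = w" for u v w :: field2
    by (simp_all add: vec_of_list_index del: vec_of_list_Cons)
  have rho: "(\<lambda>dt. deriv (\<lambda>\<tau>. \<rho> dt \<tau> p) t + (?F dt t $ 0) p) \<in> O[at_right 0](\<lambda>dt. dt\<^sup>2)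
    \<longleftrightarrow> (\<lambda>dt. deriv (\<lambda>\<tau>. \<rho> dt \<tau> p) t + divg (jx dt t) (jy dt t) p)
      \<in> O[at_right 0](\<lambda>dt. dt\<^sup>2)" for t p
    by (intro O_cong) (simp only: F component)
  have jx: "(\<lambda>dt. deriv (\<lambda>\<tau>. jx dt \<tau> p) t + (?F dt t $ 1) p) \<in> O[at_right 0](\<lambda>dt. dt\<^sup>2)
    \<longleftrightarrow> (\<lambda>dt. deriv (\<lambda>\<tau>. jx dt \<tau> p) t + c0_sq lam \<alpha> * pdx (\<rho> dt t) p
           - zeta lam \<alpha> s\<^sub>e dt * pdx (divg (jx dt t) (jy dt t)) p)
      \<in> O[at_right 0](\<lambda>dt. dt\<^sup>2)" for t p
    by (intro O_cong) (simp only: F component)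
  have jy: "(\<lambda>dt. deriv (\<lambda>\<tau>. jy dt \<tau> p) t + (?F dt t $ 2) p) \<in> O[at_right 0](\<lambda>dt. dt\<^sup>2)
    \<longleftrightarrow> (\<lambda>dt. deriv (\<lambda>\<tau>. jy dt \<tau> p) t + c0_sq lam \<alpha> * pdy (\<rho> dt t) p
           - zeta lam \<alpha> s\<^sub>e dt * pdy (divg (jx dt t) (jy dt t)) p)
      \<in> O[at_right 0](\<lambda>dt. dt\<^sup>2)" for t p
    by (intro O_cong) (simp only: F component)
  have all3: "(\<forall>i<3. P i) \<longleftrightarrow> P 0 \<and> P 1 \<and> P 2" for P :: "nat \<Rightarrow> bool"
    by (auto simp: less_Suc_eq eval_nat_numeral)
  \<comment> \<open>The explicit equations are folded back to operator form; what remains is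
    distributing quantifiers over the three components.\<close>
  show ?thesis
    unfolding second_order_equivalent_system_def all3 component
      rho[symmetric] jx[symmetric] jy[symmetric]
    by blast
qed

section \<open>Separation of shear and bulk viscosity\<close>

lemma viscous_acoustics_eq_iff:
  "(\<forall>\<rho> jx jy. smooth_field \<rho> \<longrightarrow> smooth_field jx \<longrightarrow> smooth_field jy \<longrightarrow>
      viscous_acoustics c \<nu> \<mu> \<rho> jx jy = viscous_acoustics c \<nu>' \<mu>' \<rho> jx jy)
    \<longleftrightarrow> \<nu> = \<nu>' \<and> \<mu> = \<mu>'"
proof (intro iffI; safe?)
  assume eq: "\<forall>\<rho> jx jy. smooth_field \<rho> \<longrightarrow> smooth_field jx \<longrightarrow> smooth_field jy \<longrightarrow>
    viscous_acoustics c \<nu> \<mu> \<rho> jx jy = viscous_acoustics c \<nu>' \<mu>' \<rho> jx jy"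
  have *: "\<nu> * (d + e) + \<mu> * d = \<nu>' * (d + e) + \<mu>' * d" for d e
  proof -
    \<comment> \<open>The halves make the Laplacian of \<open>?j\<close> equal to
      \<open>d + e\<close> and the x-derivative of the divergence equal to \<open>d\<close>.\<close>
    let ?z = "quad_field 0 0 0 0 0" and ?j = "quad_field 0 0 0 (d / 2) (e / 2)"
    have "(viscous_acoustics c \<nu> \<mu> ?z ?j ?z $ 1) (0, 0)
        = (viscous_acoustics c \<nu>' \<mu>' ?z ?j ?z $ 1) (0, 0)"
      using eq smooth_quad_field by metis
    then show ?thesis
      by (simp add: viscous_acoustics_def vec_of_list_index laplacian2_def pdx_divg
          smooth_quad_field pdx_quad_field pdy_quad_field)
        (simp add: quad_field_def algebra_simps)
  qed
  show "\<nu> = \<nu>'"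
    \<comment> \<open>The choice \<open>d = 0\<close>, \<open>e = 1\<close> is a divergence-free
      shear flow, so only the shear viscosity remains.\<close>
    using *[of 0 1] by simp
  with *[of 1 0] show "\<mu> = \<mu>'"
    by simp
qed

text \<open>The first conjunct ties \<open>E_eq\<close> and \<open>S_relax\<close> to the actual
  relaxation step of the scheme. The last makes the claim on viscosities precise, as uniqueness of
  the shear and bulk coefficients that reproduce the operator.\<close>

theorem proposition6:
  fixes lam \<alpha> s\<^sub>e :: real
  assumes "lam > 0" and "s\<^sub>e \<noteq> 0" and "\<alpha> + 3 \<noteq> 0"
  shows
    "J0r lam \<alpha> s\<^sub>e = relaxation_matrix (E_eq lam \<alpha>) (S_relax \<alpha> s\<^sub>e) \<and>
     (\<forall>dt>0. \<forall>\<rho> jx jy. smooth_field \<rho> \<longrightarrow> smooth_field jx \<longrightarrow> smooth_field jy \<longrightarrow>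
        op_mat_fun (equivalent_op (Lambda_r lam) (E_eq lam \<alpha>) (S_relax \<alpha> s\<^sub>e) dt)
          (vec_of_list [\<rho>, jx, jy])
        = vec_of_list
            [divg jx jy,
             \<lambda>p. c0_sq lam \<alpha> * pdx \<rho> p - zeta lam \<alpha> s\<^sub>e dt * pdx (divg jx jy) p,
             \<lambda>p. c0_sq lam \<alpha> * pdy \<rho> p - zeta lam \<alpha> s\<^sub>e dt * pdy (divg jx jy) p]) \<and>
     (\<forall>\<rho> jx jy. regular_family \<rho> \<longrightarrow> regular_family jx \<longrightarrow> regular_family jy \<longrightarrow>
        (second_order_equivalent_system (Lambda_r lam) (E_eq lam \<alpha>) (S_relax \<alpha> s\<^sub>e)
           (\<lambda>dt t. vec_of_list [\<rho> dt t, jx dt t, jy dt t])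
         \<longleftrightarrow>
         (\<forall>t p.
            (\<lambda>dt. deriv (\<lambda>\<tau>. \<rho> dt \<tau> p) t + divg (jx dt t) (jy dt t) p)
              \<in> O[at_right 0](\<lambda>dt. dt\<^sup>2) \<and>
            (\<lambda>dt. deriv (\<lambda>\<tau>. jx dt \<tau> p) t + c0_sq lam \<alpha> * pdx (\<rho> dt t) p
                 - zeta lam \<alpha> s\<^sub>e dt * pdx (divg (jx dt t) (jy dt t)) p)
              \<in> O[at_right 0](\<lambda>dt. dt\<^sup>2) \<and>
            (\<lambda>dt. deriv (\<lambda>\<tau>. jy dt \<tau> p) t + c0_sq lam \<alpha> * pdy (\<rho> dt t) p
                 - zeta lam \<alpha> s\<^sub>e dt * pdy (divg (jx dt t) (jy dt t)) p)
              \<in> O[at_right 0](\<lambda>dt. dt\<^sup>2)))) \<and>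
     (\<forall>dt>0. \<forall>\<nu> \<mu>.
        (\<forall>\<rho> jx jy. smooth_field \<rho> \<longrightarrow> smooth_field jx \<longrightarrow> smooth_field jy \<longrightarrow>
           op_mat_fun (equivalent_op (Lambda_r lam) (E_eq lam \<alpha>) (S_relax \<alpha> s\<^sub>e) dt)
             (vec_of_list [\<rho>, jx, jy])
           = viscous_acoustics (c0_sq lam \<alpha>) \<nu> \<mu> \<rho> jx jy)
        \<longleftrightarrow> \<nu> = 0 \<and> \<mu> = zeta lam \<alpha> s\<^sub>e dt)"
proof -
  have lam: "lam \<noteq> 0"
    using assms(1) by simp
  note acoustics = op_mat_fun_equivalent_op[OF lam assms(2,3)]
  have viscous: "op_mat_fun (equivalent_op (Lambda_r lam) (E_eq lam \<alpha>) (S_relax \<alpha> s\<^sub>e) dt)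
      (vec_of_list [\<rho>, jx, jy])
    = viscous_acoustics (c0_sq lam \<alpha>) 0 (zeta lam \<alpha> s\<^sub>e dt) \<rho> jx jy"
    if "smooth_field \<rho>" "smooth_field jx" "smooth_field jy" for dt \<rho> jx jy
    unfolding acoustics[OF that] viscous_acoustics_def by simp
  have "(\<forall>\<rho> jx jy. smooth_field \<rho> \<longrightarrow> smooth_field jx \<longrightarrow> smooth_field jy \<longrightarrow>
      op_mat_fun (equivalent_op (Lambda_r lam) (E_eq lam \<alpha>) (S_relax \<alpha> s\<^sub>e) dt)
        (vec_of_list [\<rho>, jx, jy])
      = viscous_acoustics (c0_sq lam \<alpha>) \<nu> \<mu> \<rho> jx jy)
    \<longleftrightarrow> \<nu> = 0 \<and> \<mu> = zeta lam \<alpha> s\<^sub>e dt" for dt \<nu> \<mu>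
    \<comment> \<open>The condition on the coefficients is restated as equality of two acoustic
      operators on smooth fields; \<open>viscous\<close> turns the operator of the scheme into one
      of them.\<close>
    unfolding viscous_acoustics_eq_iff[of "c0_sq lam \<alpha>" \<nu> \<mu> 0 "zeta lam \<alpha> s\<^sub>e dt", symmetric]
    by (simp only: viscous eq_commute[of "viscous_acoustics _ \<nu> \<mu> _ _ _"] cong: imp_cong)
  then show ?thesis
    using J0r_eq_relaxation_matrix[OF lam] acoustics
      second_order_equivalent_system_Lambda_r[OF lam assms(2,3)]
    by blast
qed

end
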